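(* Let $M$ and $M'$ be matroids without loops and without coloops, let $P$ be a condensation of $\mathcal Z(M)$ with system of representatives $\{R_B\}_{B\in P}$, and let $P'$ be a condensation of $\mathcal Z(M')$ with system of representatives $\{R'_{B'}\}_{B'\in P'}$. Suppose there is a bijection $\varphi:P\to P'$ such that for all $B,C\in P$: $A_{P'}(\varphi(B),\varphi(C))=A_P(B,C)$, $|R'_{\varphi(B)}|=|R_B|$ and $r_{M'}(R'_{\varphi(B)})=r_M(R_B)$. Then $R_M(x,y)=R_{M'}(x,y)$, where $R_N(x,y)=\sum_{X\subseteq E(N)}x^{r_N(E(N))-r_N(X)}y^{|X|-r_N(X)}$ is the rank generating polynomial. That is, the rank generating polynomial (equivalently the Tutte polynomial $T_N(x,y)=R_N(x-1,y-1)$) is determined by a condensed configuration.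
   Context: A flat $X$ of a matroid $N$ is cyclic if $N|X$ has no coloops; $\mathcal Z(N)$ is the set of cyclic flats. A partition $P$ of $\mathcal Z(N)$ is a condensation if for all blocks $B,C\in P$: (1) cardinality and rank are constant on $B$; (2) the number $A_P(B,C):=|\{X\in B: X\subseteq Y\}|$ is independent of the choice of $Y\in C$. The condensed configuration corresponding to $P$ consists of the matrix $(A_P(B,C))_{B,C\in P}$ and the cardinality and rank of a representative $R_B$ of each block $B$. *)

theory Defs
  imports "HOL-Library.Disjoint_Sets" "HOL-Computational_Algebra.Polynomial"
begin

record 'a matroid =
  ground :: "'a set"
  indeps :: "'a set set"

locale matroid =
  fixes M :: "'a matroid"
  assumes finite_ground: "finite (ground M)"
    and indep_subset_ground: "I \<in> indeps M \<Longrightarrow> I \<subseteq> ground M"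
    and indep_empty: "{} \<in> indeps M"
    and indep_subset: "I \<in> indeps M \<Longrightarrow> J \<subseteq> I \<Longrightarrow> J \<in> indeps M"
    and indep_augment: "I \<in> indeps M \<Longrightarrow> J \<in> indeps M \<Longrightarrow> card I < card J \<Longrightarrow>
      \<exists>e\<in>J - I. insert e I \<in> indeps M"

definition rank :: "'a matroid \<Rightarrow> 'a set \<Rightarrow> nat" where
  "rank M X = Max (card ` {I \<in> indeps M. I \<subseteq> X})"

definition bases :: "'a matroid \<Rightarrow> 'a set set" where
  "bases M = {I \<in> indeps M. \<forall>J\<in>indeps M. I \<subseteq> J \<longrightarrow> I = J}"

definition loop :: "'a matroid \<Rightarrow> 'a \<Rightarrow> bool" where
  "loop M e \<longleftrightarrow> e \<in> ground M \<and> {e} \<notin> indeps M"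

definition coloop :: "'a matroid \<Rightarrow> 'a \<Rightarrow> bool" where
  "coloop M e \<longleftrightarrow> e \<in> ground M \<and> (\<forall>B\<in>bases M. e \<in> B)"

definition restriction :: "'a matroid \<Rightarrow> 'a set \<Rightarrow> 'a matroid" where
  "restriction M X = \<lparr>ground = X, indeps = {I \<in> indeps M. I \<subseteq> X}\<rparr>"

lemma (in matroid) matroid_restriction:
  assumes "X \<subseteq> ground M"
  shows "matroid (restriction M X)"
proof
  show "finite (ground (restriction M X))"
    using assms finite_ground by (auto simp: restriction_def intro: finite_subset)
  show "\<exists>e\<in>J - I. insert e I \<in> indeps (restriction M X)"
    if "I \<in> indeps (restriction M X)" "J \<in> indeps (restriction M X)" "card I < card J" for I J
    using indep_augment[of I J] that by (auto simp: restriction_def)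
qed (use indep_empty indep_subset in \<open>auto simp: restriction_def\<close>)

definition flat :: "'a matroid \<Rightarrow> 'a set \<Rightarrow> bool" where
  "flat M X \<longleftrightarrow> X \<subseteq> ground M \<and> (\<forall>e\<in>ground M - X. rank M X < rank M (insert e X))"

definition cyclic_flats :: "'a matroid \<Rightarrow> 'a set set" where
  "cyclic_flats M = {X. flat M X \<and> \<not> (\<exists>e. coloop (restriction M X) e)}"

definition condensation :: "'a matroid \<Rightarrow> 'a set set set \<Rightarrow> bool" where
  "condensation M P \<longleftrightarrow> partition_on (cyclic_flats M) P \<and>
     (\<forall>B\<in>P. \<forall>X\<in>B. \<forall>Y\<in>B. card X = card Y \<and> rank M X = rank M Y) \<and>
     (\<forall>B\<in>P. \<forall>C\<in>P. \<forall>Y\<in>C. \<forall>Y'\<in>C. card {X \<in> B. X \<subseteq> Y} = card {X \<in> B. X \<subseteq> Y'})"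

text \<open>Meaningful for blocks of a condensation, where the count does not depend on \<open>Y\<close>.\<close>

definition incidence :: "'a set set \<Rightarrow> 'a set set \<Rightarrow> nat" where
  "incidence B C = (THE n. \<forall>Y\<in>C. card {X \<in> B. X \<subseteq> Y} = n)"

lemma incidence_eq:
  assumes "condensation M P" "B \<in> P" "C \<in> P" "Y \<in> C"
  shows "incidence B C = card {X \<in> B. X \<subseteq> Y}"
  unfolding incidence_def
proof (rule the_equality)
  show "\<forall>Z\<in>C. card {X \<in> B. X \<subseteq> Z} = card {X \<in> B. X \<subseteq> Y}"
    using assms unfolding condensation_def by blast
qed (use assms(4) in auto)

text \<open>
  Bivariate integer polynomials are elements of \<open>\<int>[y][x]\<close>: the outer variable is \<open>x\<close>, the
  coefficients are polynomials in \<open>y\<close>. The exponents involve no truncated subtraction, as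
  \<open>rank M X \<le> rank M (ground M)\<close> and \<open>rank M X \<le> card X\<close> for \<open>X \<subseteq> ground M\<close>.
\<close>

definition rank_gen_poly :: "'a matroid \<Rightarrow> int poly poly" where
  "rank_gen_poly M =
     (\<Sum>X\<in>Pow (ground M). monom (monom 1 (card X - rank M X)) (rank M (ground M) - rank M X))"

lemma poly_rank_gen_poly:
  "poly (poly (rank_gen_poly M) [:x:]) y =
     (\<Sum>X\<in>Pow (ground M). x ^ (rank M (ground M) - rank M X) * y ^ (card X - rank M X))"
  by (simp add: rank_gen_poly_def poly_sum poly_monom mult.commute)

text \<open>Both variables are shifted: the inner composition replaces \<open>y\<close> by \<open>y - 1\<close>, the outer
  one \<open>x\<close> by \<open>x - 1\<close>.\<close>

definition tutte_poly :: "'a matroid \<Rightarrow> int poly poly" where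
  "tutte_poly M = pcompose (map_poly (\<lambda>p. pcompose p [:-1, 1:]) (rank_gen_poly M)) [:-1, 1:]"

end

theory Submission
  imports Defs
begin

text \<open>
  The closure \<open>Y\<close> of the cyclic part of a set \<open>X\<close> is a cyclic flat, and \<open>X\<close> is determined by \<open>Y\<close>, by
  \<open>X \<inter> Y\<close> (a cyclic set spanning \<open>Y\<close>) and by \<open>X \<union> Y\<close> (independent in the contraction by \<open>Y\<close>).
  Let \<open>c(Z, Y)\<close> and \<open>i(Y, W)\<close> be the polynomials counting, by size relative to the lower end, the
  cyclic sets between \<open>Z\<close> and \<open>Y\<close> that span \<open>Y\<close> and the sets between \<open>Y\<close> and \<open>W\<close> that are
  independent over \<open>Y\<close>. Sorting the subsets of \<open>W\<close> containing \<open>Z\<close> by \<open>Y\<close> gives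
  \<open>(\<Sum>Y. c(Z, Y) * i(Y, W)) = (1 + t) ^ (|W| - |Z|)\<close>, and in the same way the rank generating
  polynomial is determined by all the \<open>c({}, Y)\<close> and \<open>i(Y, E)\<close>.

  Sum this over all \<open>Z\<close> in a block \<open>B\<close>, and let \<open>W\<close> lie in a block \<open>C \<noteq> B\<close>. The right-hand side becomes
  \<open>A(B, C) (1 + t) ^ (|C| - |B|)\<close>; on the left the extreme terms are \<open>c(B, W) + i(B, W)\<close>
  (sums over the \<open>Z\<close> in \<open>B\<close> below \<open>W\<close>), and the others involve only blocks of rank strictly between those of \<open>B\<close> and \<open>C\<close>. Since \<open>c(B, W)\<close> lives in
  degrees above \<open>r(C) - r(B)\<close> and \<open>i(B, W)\<close> in degrees at most \<open>r(C) - r(B)\<close>, the sum determines both,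
  and induction on the rank difference shows that they depend only on the condensed configuration.
\<close>

section \<open>Rank, cyclic sets and closure\<close>

context matroid
begin

lemma finite_indeps_below: "finite {I \<in> indeps M. I \<subseteq> X}"
  by (rule finite_subset[of _ "Pow (ground M)"]) (use indep_subset_ground finite_ground in auto)

lemma finite_indep: "I \<in> indeps M \<Longrightarrow> finite I"
  using indep_subset_ground finite_ground finite_subset by blast

lemma card_le_rank: "I \<in> indeps M \<Longrightarrow> I \<subseteq> X \<Longrightarrow> card I \<le> rank M X"
  unfolding rank_def using finite_indeps_below by (intro Max_ge) auto

lemma rank_witness:
  obtains I where "I \<in> indeps M" "I \<subseteq> X" "card I = rank M X"
proof -
  have "rank M X \<in> card ` {I \<in> indeps M. I \<subseteq> X}"
    unfolding rank_def using finite_indeps_below indep_empty by (intro Max_in) auto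
  then show thesis using that by auto
qed

lemma rank_mono: "X \<subseteq> Y \<Longrightarrow> rank M X \<le> rank M Y"
  by (metis rank_witness card_le_rank subset_trans)

lemma rank_le_card: "finite X \<Longrightarrow> rank M X \<le> card X"
  by (metis rank_witness card_mono)

lemma rank_empty [simp]: "rank M {} = 0"
  using rank_le_card[of "{}"] by simp

text \<open>As long as \<open>I\<close> is smaller than the rank, augmentation from a maximum
  independent subset of \<open>X\<close> supplies one more element; the induction is on the missing
  rank.\<close>

lemma indep_extend:
  assumes "I \<in> indeps M" "I \<subseteq> X"
  obtains J where "J \<in> indeps M" "I \<subseteq> J" "J \<subseteq> X" "card J = rank M X"
proof -
  have "\<exists>J. J \<in> indeps M \<and> I \<subseteq> J \<and> J \<subseteq> X \<and> card J = rank M X"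
    using assms
  proof (induction "rank M X - card I" arbitrary: I rule: less_induct)
    case less
    show ?case
    proof (cases "card I = rank M X")
      case True
      then show ?thesis using less.prems by blast
    next
      case False
      then have lt: "card I < rank M X"
        using card_le_rank less.prems by (meson le_neq_implies_less)
      obtain K where K: "K \<in> indeps M" "K \<subseteq> X" "card K = rank M X" by (rule rank_witness)
      then obtain e where e: "e \<in> K - I" "insert e I \<in> indeps M"
        using indep_augment less.prems lt by metis
      then have "card (insert e I) = Suc (card I)"
        using finite_indep less.prems by simp
      then have "\<exists>J. J \<in> indeps M \<and> insert e I \<subseteq> J \<and> J \<subseteq> X \<and> card J = rank M X"
        using e K lt less.prems by (intro less.hyps) auto
      then show ?thesis by auto
    qed
  qed
  then show thesis using that by blast
qed

text \<open>A maximum independent subset \<open>I\<close> of \<open>X \<inter> Y\<close> is extended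
  to one \<open>J\<close> of \<open>X \<union> Y\<close>. Both traces of \<open>J\<close> on
  \<open>X\<close> and on \<open>Y\<close> are independent, and they overlap at least in
  \<open>I\<close>.\<close>

lemma rank_submodular: "rank M (X \<union> Y) + rank M (X \<inter> Y) \<le> rank M X + rank M Y"
proof -
  obtain I where I: "I \<in> indeps M" "I \<subseteq> X \<inter> Y" "card I = rank M (X \<inter> Y)"
    by (rule rank_witness)
  then obtain J where J: "J \<in> indeps M" "I \<subseteq> J" "J \<subseteq> X \<union> Y" "card J = rank M (X \<union> Y)"
    using indep_extend[of I "X \<union> Y"] by auto
  have fin: "finite J" using J finite_indep by blast
  have "card (J \<inter> X) \<le> rank M X" "card (J \<inter> Y) \<le> rank M Y"
    using J indep_subset[of J] by (auto intro!: card_le_rank)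
  moreover have "card I \<le> card (J \<inter> X \<inter> (J \<inter> Y))"
    using I J fin by (intro card_mono) auto
  moreover have "card (J \<inter> X) + card (J \<inter> Y) = card (J \<inter> X \<union> J \<inter> Y) + card (J \<inter> X \<inter> (J \<inter> Y))"
    using fin by (intro card_Un_Int) auto
  moreover have "J \<inter> X \<union> J \<inter> Y = J" using J by auto
  ultimately show ?thesis using I J by simp
qed

lemma rank_Un_le: "finite S \<Longrightarrow> rank M (X \<union> S) \<le> rank M X + card S"
  using rank_submodular[of X S] rank_le_card[of S] by linarith

text \<open>Monotonicity of closure in terms of rank: submodularity for \<open>Y\<close> and
  \<open>insert e X\<close>, whose intersection is \<open>X\<close> when \<open>e\<close> lies
  outside \<open>Y\<close>.\<close>

lemma rank_insert_mono:
  assumes "rank M (insert e X) = rank M X" "X \<subseteq> Y"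
  shows "rank M (insert e Y) = rank M Y"
proof (cases "e \<in> Y")
  case False
  then have "Y \<union> insert e X = insert e Y" "Y \<inter> insert e X = X" using assms by auto
  then have "rank M (insert e Y) \<le> rank M Y"
    using rank_submodular[of Y "insert e X"] assms by simp
  then show ?thesis using rank_mono[OF subset_insertI, of Y e] by simp
qed (simp add: insert_absorb)

text \<open>An element on a circuit inside \<open>X\<close> is on a circuit inside every larger set,
  so it cannot become a coloop there.\<close>

lemma rank_Diff_mono:
  assumes "rank M (X - {e}) = rank M X" "X \<subseteq> Y" "e \<in> X"
  shows "rank M (Y - {e}) = rank M Y"
  using rank_insert_mono[of e "X - {e}" "Y - {e}"] assms
  by (metis Diff_mono insert_Diff subset_iff subset_refl)

text \<open>By \<open>indep_extend\<close>, maximality under inclusion and maximality in size agree.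
  This translates bases, and then coloops, into rank.\<close>

lemma bases_restriction:
  "B \<in> bases (restriction M X) \<longleftrightarrow> B \<in> indeps M \<and> B \<subseteq> X \<and> card B = rank M X"
proof
  assume B: "B \<in> bases (restriction M X)"
  then have "B \<in> indeps M" "B \<subseteq> X" by (auto simp: bases_def restriction_def)
  moreover from this obtain J where "J \<in> indeps M" "B \<subseteq> J" "J \<subseteq> X" "card J = rank M X"
    by (rule indep_extend)
  moreover from this have "B = J" using B by (auto simp: bases_def restriction_def)
  ultimately show "B \<in> indeps M \<and> B \<subseteq> X \<and> card B = rank M X" by simp
next
  assume B: "B \<in> indeps M \<and> B \<subseteq> X \<and> card B = rank M X"
  then have "B = J" if "J \<in> indeps M" "J \<subseteq> X" "B \<subseteq> J" for J
    using that card_le_rank[of J X] finite_indep by (metis card_seteq)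
  then show "B \<in> bases (restriction M X)"
    using B by (auto simp: bases_def restriction_def)
qed

lemma coloop_restriction:
  "coloop (restriction M X) e \<longleftrightarrow> e \<in> X \<and> rank M (X - {e}) \<noteq> rank M X"
proof -
  have "(\<forall>B\<in>bases (restriction M X). e \<in> B) \<longleftrightarrow> rank M (X - {e}) \<noteq> rank M X" if "e \<in> X"
  proof
    assume *: "\<forall>B\<in>bases (restriction M X). e \<in> B"
    obtain I where "I \<in> indeps M" "I \<subseteq> X - {e}" "card I = rank M (X - {e})"
      by (rule rank_witness)
    then show "rank M (X - {e}) \<noteq> rank M X"
      using * bases_restriction[of I X] by auto
  next
    assume *: "rank M (X - {e}) \<noteq> rank M X"
    then have lt: "rank M (X - {e}) < rank M X"
      using rank_mono[of "X - {e}" X] by auto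
    show "\<forall>B\<in>bases (restriction M X). e \<in> B"
    proof (rule ballI, rule ccontr)
      fix B assume "B \<in> bases (restriction M X)" "e \<notin> B"
      then show False
        using card_le_rank[of B "X - {e}"] lt by (auto simp: bases_restriction)
    qed
  qed
  then show ?thesis by (auto simp: coloop_def restriction_def)
qed

end

section \<open>Cyclic sets, the cyclic part and closure\<close>

definition cyclic :: "'a matroid \<Rightarrow> 'a set \<Rightarrow> bool" where
  "cyclic M X \<longleftrightarrow> (\<forall>e\<in>X. rank M (X - {e}) = rank M X)"

text \<open>The complement in \<open>X\<close> of the coloops of the restriction to
  \<open>X\<close>; equivalently the union of the circuits contained in \<open>X\<close>.\<close>

definition cyclic_part :: "'a matroid \<Rightarrow> 'a set \<Rightarrow> 'a set" where
  "cyclic_part M X = {e \<in> X. rank M (X - {e}) = rank M X}"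

definition closure :: "'a matroid \<Rightarrow> 'a set \<Rightarrow> 'a set" where
  "closure M X = {e \<in> ground M. rank M (insert e X) = rank M X}"

context matroid
begin

lemma cyclic_flats_iff: "X \<in> cyclic_flats M \<longleftrightarrow> flat M X \<and> cyclic M X"
  by (auto simp: cyclic_flats_def cyclic_def coloop_restriction)

lemma cyclic_flats_subset_ground: "X \<in> cyclic_flats M \<Longrightarrow> X \<subseteq> ground M"
  by (auto simp: cyclic_flats_def flat_def)

lemma finite_cyclic_flats: "finite (cyclic_flats M)"
  by (rule finite_subset[of _ "Pow (ground M)"])
     (use finite_ground in \<open>auto simp: cyclic_flats_def flat_def\<close>)

lemma finite_cyclic_flat: "X \<in> cyclic_flats M \<Longrightarrow> finite X"
  using cyclic_flats_subset_ground finite_ground finite_subset by blast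

lemma flat_rank_less:
  assumes "flat M X" "X \<subset> Y" "Y \<subseteq> ground M"
  shows "rank M X < rank M Y"
proof -
  obtain e where "e \<in> Y - X" using assms by auto
  then have "rank M X < rank M (insert e X)" "insert e X \<subseteq> Y"
    using assms by (auto simp: flat_def)
  then show ?thesis using rank_mono[of "insert e X" Y] by linarith
qed

lemma cyclic_flat_rank_less:
  "X \<in> cyclic_flats M \<Longrightarrow> Y \<in> cyclic_flats M \<Longrightarrow> X \<subset> Y \<Longrightarrow> rank M X < rank M Y"
  using flat_rank_less cyclic_flats_subset_ground cyclic_flats_iff by blast

lemma empty_cyclic_flat:
  assumes "\<not> (\<exists>e. loop M e)"
  shows "{} \<in> cyclic_flats M"
proof -
  have "rank M {e} > 0" if "e \<in> ground M" for e
    using assms that card_le_rank[of "{e}" "{e}"] by (auto simp: loop_def)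
  then show ?thesis by (auto simp: cyclic_flats_iff cyclic_def flat_def)
qed

lemma ground_cyclic_flat:
  assumes "\<not> (\<exists>e. coloop M e)"
  shows "ground M \<in> cyclic_flats M"
proof -
  have "{I \<in> indeps M. I \<subseteq> ground M} = indeps M" using indep_subset_ground by auto
  then have "coloop (restriction M (ground M)) e \<longleftrightarrow> coloop M e" for e
    by (simp add: coloop_def bases_def restriction_def)
  then show ?thesis using assms by (auto simp: cyclic_flats_def flat_def)
qed

lemma cyclic_part_subset: "cyclic_part M X \<subseteq> X"
  by (auto simp: cyclic_part_def)

text \<open>The elements outside the cyclic part are coloops of the restriction to \<open>X\<close>,
  so each of them carries exactly one unit of rank.\<close>

lemma rank_cyclic_part:
  assumes "finite X"
  shows "rank M X = rank M (cyclic_part M X) + card (X - cyclic_part M X)"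
proof -
  \<comment> \<open>The coloops are removed one at a time. Submodularity for \<open>X - S\<close>
    and \<open>X - {e}\<close> shows that removing \<open>e\<close> still lowers the rank once
    \<open>S\<close> is gone.\<close>
  have "rank M (X - S) + card S \<le> rank M X" if "S \<subseteq> X - cyclic_part M X" for S
  proof -
    have "finite S" using that assms finite_subset by auto
    then show ?thesis using that
    proof (induction S rule: finite_induct)
      case (insert e S)
      have "rank M (X - {e}) < rank M X"
        using insert.prems rank_mono[of "X - {e}" X] by (auto simp: cyclic_part_def)
      moreover have "X - S \<union> (X - {e}) = X" "(X - S) \<inter> (X - {e}) = X - insert e S"
        using insert by auto
      ultimately show ?case using rank_submodular[of "X - S" "X - {e}"] insert by simp
    qed simp
  qed
  from this[of "X - cyclic_part M X"]
  have "rank M (cyclic_part M X) + card (X - cyclic_part M X) \<le> rank M X"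
    using cyclic_part_subset[of X] by (simp add: double_diff)
  moreover have "rank M X \<le> rank M (cyclic_part M X) + card (X - cyclic_part M X)"
    using rank_Un_le[of "X - cyclic_part M X" "cyclic_part M X"] assms cyclic_part_subset[of X]
    by (simp add: Un_absorb1)
  ultimately show ?thesis by simp
qed

text \<open>For \<open>e\<close> in the cyclic part, \<open>X - {e}\<close> keeps the rank of
  \<open>X\<close>. The coloops account for only \<open>card (X - ?C)\<close> of it, so the rest of
  the cyclic part must already have full rank.\<close>

lemma cyclic_cyclic_part:
  assumes "finite X"
  shows "cyclic M (cyclic_part M X)"
  unfolding cyclic_def
proof
  fix e assume e: "e \<in> cyclic_part M X"
  let ?C = "cyclic_part M X"
  have "(?C - {e}) \<union> (X - ?C) = X - {e}" using e cyclic_part_subset[of X] by auto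
  then have "rank M X \<le> rank M (?C - {e}) + card (X - ?C)"
    using rank_Un_le[of "X - ?C" "?C - {e}"] e assms by (auto simp: cyclic_part_def)
  then have "rank M ?C \<le> rank M (?C - {e})" using rank_cyclic_part[OF assms] by simp
  then show "rank M (?C - {e}) = rank M ?C"
    using rank_mono[of "?C - {e}" ?C] by auto
qed

lemma subset_closure: "X \<subseteq> ground M \<Longrightarrow> X \<subseteq> closure M X"
  by (auto simp: closure_def insert_absorb)

lemma rank_closure:
  assumes "X \<subseteq> ground M"
  shows "rank M (closure M X) = rank M X"
proof -
  \<comment> \<open>The claim for all subsets \<open>S\<close> of the closure allows adding elements
    singly: an element that does not raise the rank of \<open>X\<close> does not raise that of
    \<open>X \<union> S\<close> either.\<close>
  have "rank M (X \<union> S) = rank M X" if "S \<subseteq> closure M X" for S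
  proof -
    have "finite S" using that finite_ground finite_subset by (fastforce simp: closure_def)
    then show ?thesis using that
    proof (induction S rule: finite_induct)
      case (insert e S)
      then have "rank M (insert e X) = rank M X" by (simp add: closure_def)
      then show ?case using rank_insert_mono[of e X "X \<union> S"] insert by simp
    qed simp
  qed
  from this[of "closure M X"] show ?thesis
    using subset_closure[OF assms] by (simp add: Un_absorb1)
qed

lemma flat_closure:
  assumes "X \<subseteq> ground M"
  shows "flat M (closure M X)"
  unfolding flat_def
proof (intro conjI ballI)
  fix e assume e: "e \<in> ground M - closure M X"
  then have "rank M X < rank M (insert e X)"
    using rank_mono[OF subset_insertI, of X e] by (auto simp: closure_def)
  also have "\<dots> \<le> rank M (insert e (closure M X))"
    using subset_closure[OF assms] by (intro rank_mono) auto
  finally show "rank M (closure M X) < rank M (insert e (closure M X))"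
    using rank_closure[OF assms] by simp
qed (auto simp: closure_def)

lemma cyclic_closure:
  assumes "X \<subseteq> ground M" "cyclic M X"
  shows "cyclic M (closure M X)"
  unfolding cyclic_def
proof
  fix e assume e: "e \<in> closure M X"
  show "rank M (closure M X - {e}) = rank M (closure M X)"
  proof (cases "e \<in> X")
    case True
    then show ?thesis
      using rank_Diff_mono assms subset_closure by (auto simp: cyclic_def)
  next
    case False
    then have "X \<subseteq> closure M X - {e}" using subset_closure assms by auto
    then show ?thesis using rank_mono rank_closure assms
      by (metis Diff_subset le_antisym)
  qed
qed

lemma closure_subset_flat:
  assumes "flat M W" "X \<subseteq> W"
  shows "closure M X \<subseteq> W"
proof
  fix e assume "e \<in> closure M X"
  then have "e \<in> ground M" "rank M (insert e W) = rank M W"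
    using rank_insert_mono[of e X W] assms by (auto simp: closure_def)
  then show "e \<in> W" using assms(1) unfolding flat_def by (metis Diff_iff less_irrefl)
qed

lemma flat_eq_closure:
  assumes "flat M Y" "C \<subseteq> Y" "rank M C = rank M Y"
  shows "Y = closure M C"
proof
  have "C \<subseteq> ground M" using assms by (auto simp: flat_def)
  show "Y \<subseteq> closure M C"
    using assms rank_mono[of C] rank_mono[of _ Y]
    by (auto simp: closure_def flat_def) (metis insert_subset le_antisym subset_insertI)
qed (use assms closure_subset_flat in auto)

end

section \<open>Decomposition along cyclic flats\<close>

text \<open>Cyclicity refers to \<open>M\<close> itself. For cyclic \<open>Z\<close> it amounts to
  \<open>C - Z\<close> being cyclic in the contraction by \<open>Z\<close>.\<close>

definition spanning_cyclic :: "'a matroid \<Rightarrow> 'a set \<Rightarrow> 'a set \<Rightarrow> 'a set set" where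
  "spanning_cyclic M Z Y = {C. Z \<subseteq> C \<and> C \<subseteq> Y \<and> cyclic M C \<and> rank M C = rank M Y}"

text \<open>The rank equation says that \<open>J - Y\<close> is independent in the contraction by
  \<open>Y\<close>, so no contracted matroid has to be constructed.\<close>

definition indep_over :: "'a matroid \<Rightarrow> 'a set \<Rightarrow> 'a set \<Rightarrow> 'a set set" where
  "indep_over M Y W = {J. Y \<subseteq> J \<and> J \<subseteq> W \<and> rank M J = rank M Y + card (J - Y)}"

context matroid
begin

lemma finite_spanning_cyclic: "finite Y \<Longrightarrow> finite (spanning_cyclic M Z Y)"
  by (rule finite_subset[of _ "Pow Y"]) (auto simp: spanning_cyclic_def)

lemma finite_indep_over: "finite W \<Longrightarrow> finite (indep_over M Y W)"
  by (rule finite_subset[of _ "Pow W"]) (auto simp: indep_over_def)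

text \<open>The glued set meets \<open>Y\<close> in \<open>C\<close> and together with
  \<open>Y\<close> gives \<open>J\<close>. Submodularity bounds its rank from below by that of
  \<open>J\<close>, since \<open>C\<close> spans \<open>Y\<close>; counting the added elements gives
  the upper bound.\<close>

lemma rank_glue:
  assumes "C \<in> spanning_cyclic M Z Y" "J \<in> indep_over M Y W" "finite W"
  shows "rank M (C \<union> (J - Y)) = rank M Y + card (J - Y)"
proof -
  have *: "(C \<union> (J - Y)) \<union> Y = J" "(C \<union> (J - Y)) \<inter> Y = C" "finite (J - Y)"
    using assms finite_subset by (auto simp: spanning_cyclic_def indep_over_def)
  have "rank M J + rank M C \<le> rank M (C \<union> (J - Y)) + rank M Y"
    using rank_submodular[of "C \<union> (J - Y)" Y] unfolding * by simp
  moreover have "rank M (C \<union> (J - Y)) \<le> rank M C + card (J - Y)"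
    using rank_Un_le * by simp
  ultimately show ?thesis using assms by (auto simp: spanning_cyclic_def indep_over_def)
qed

lemma card_glue:
  assumes "C \<in> spanning_cyclic M Z Y" "J \<in> indep_over M Y W" "finite W"
  shows "card (C \<union> (J - Y)) = card C + card (J - Y)"
  using assms finite_subset[of J W] finite_subset[of C J]
  by (intro card_Un_disjoint) (auto simp: spanning_cyclic_def indep_over_def)

text \<open>Elements of the cyclic set \<open>C\<close> remain removable in the larger set. Without
  an element of \<open>J - Y\<close> too few elements are left over \<open>C\<close> to reach the
  rank from \<open>rank_glue\<close>.\<close>

lemma cyclic_part_glue:
  assumes "C \<in> spanning_cyclic M Z Y" "J \<in> indep_over M Y W" "finite W"
  shows "cyclic_part M (C \<union> (J - Y)) = C"
proof -
  let ?X = "C \<union> (J - Y)"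
  have C: "C \<subseteq> Y" "cyclic M C" "rank M C = rank M Y" and J: "J \<subseteq> W"
    using assms by (auto simp: spanning_cyclic_def indep_over_def)
  have "rank M (?X - {e}) = rank M ?X" if "e \<in> C" for e
    using rank_Diff_mono[of C e ?X] C that by (auto simp: cyclic_def)
  moreover have "rank M (?X - {e}) \<noteq> rank M ?X" if e: "e \<in> J - Y" for e
  proof -
    have fin: "finite (J - Y)" using J assms(3) finite_subset by auto
    have "?X - {e} = C \<union> (J - Y - {e})" using e C by auto
    then have "rank M (?X - {e}) \<le> rank M C + card (J - Y - {e})"
      using rank_Un_le[of "J - Y - {e}" C] fin by simp
    also have "\<dots> < rank M C + card (J - Y)"
      using card_Diff1_less[OF fin e] by simp
    finally show ?thesis using rank_glue[OF assms] C by simp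
  qed
  ultimately show ?thesis by (auto simp: cyclic_part_def)
qed

text \<open>The inverse sends \<open>X\<close> to the closure \<open>Y\<close> of its cyclic part,
  the cyclic part itself, and \<open>X \<union> Y\<close>. The flat \<open>Y\<close> is recovered
  from \<open>C\<close> because a flat is the closure of any subset of full rank.\<close>

lemma bij_betw_glue:
  assumes Z: "Z \<in> cyclic_flats M" and W: "W \<in> cyclic_flats M"
  shows "bij_betw (\<lambda>(Y, C, J). C \<union> (J - Y))
    (SIGMA Y:{Y \<in> cyclic_flats M. Z \<subseteq> Y \<and> Y \<subseteq> W}. spanning_cyclic M Z Y \<times> indep_over M Y W)
    {X. Z \<subseteq> X \<and> X \<subseteq> W}" (is "bij_betw ?f ?A ?B")
proof -
  let ?g = "\<lambda>X. (closure M (cyclic_part M X), cyclic_part M X, X \<union> closure M (cyclic_part M X))"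
  note finW = finite_cyclic_flat[OF W]
  have flatW: "flat M W" and WE: "W \<subseteq> ground M"
    using W cyclic_flats_iff cyclic_flats_subset_ground by auto
  have eq: "cyclic_part M X \<union> (X \<union> closure M (cyclic_part M X) - closure M (cyclic_part M X)) = X"
    and inter: "X \<inter> closure M (cyclic_part M X) = cyclic_part M X"
    if "X \<subseteq> W" for X
  proof -
    let ?C = "cyclic_part M X"
    have finX: "finite X" using that finW finite_subset by blast
    have sub: "?C \<subseteq> closure M ?C"
      using subset_closure cyclic_part_subset that WE by (meson subset_trans)
    \<comment> \<open>Such an \<open>e\<close> is a coloop of the restriction to \<open>X\<close>;
      in the closure of the cyclic part, which avoids \<open>e\<close>, it would not raise the rank
      of \<open>X - {e}\<close>.\<close>
    have "e \<notin> closure M ?C" if e: "e \<in> X - ?C" for e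
    proof
      assume "e \<in> closure M ?C"
      then have "rank M (insert e (X - {e})) = rank M (X - {e})"
        using rank_insert_mono[of e ?C "X - {e}"] e cyclic_part_subset[of X]
        by (auto simp: closure_def)
      then show False using e by (auto simp: cyclic_part_def insert_absorb)
    qed
    then show "?C \<union> (X \<union> closure M ?C - closure M ?C) = X" "X \<inter> closure M ?C = ?C"
      using sub cyclic_part_subset[of X] by auto
  qed
  have left: "\<forall>t\<in>?A. ?g (?f t) = t"
  proof
    fix t assume "t \<in> ?A"
    then obtain Y C J where t: "t = (Y, C, J)" and Y: "Y \<in> cyclic_flats M"
      and C: "C \<in> spanning_cyclic M Z Y" and J: "J \<in> indep_over M Y W" by blast
    have "closure M C = Y"
      using flat_eq_closure[of Y C] Y C by (auto simp: cyclic_flats_iff spanning_cyclic_def)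
    moreover have "C \<union> (J - Y) \<union> Y = J" using C J by (auto simp: spanning_cyclic_def indep_over_def)
    ultimately show "?g (?f t) = t"
      by (simp add: t cyclic_part_glue[OF C J finW])
  qed
  have right: "\<forall>X\<in>?B. ?f (?g X) = X"
    using eq by simp
  have im: "?f ` ?A \<subseteq> ?B"
    by (auto simp: spanning_cyclic_def indep_over_def)
  have im2: "?g ` ?B \<subseteq> ?A"
  proof (rule image_subsetI)
    fix X assume "X \<in> ?B"
    then have X: "Z \<subseteq> X" "X \<subseteq> W" by auto
    let ?C = "cyclic_part M X" and ?Y = "closure M (cyclic_part M X)"
    have finX: "finite X" using X finW finite_subset by blast
    have CE: "?C \<subseteq> ground M" using X WE cyclic_part_subset[of X] by auto
    have cyc: "cyclic M ?C" using cyclic_cyclic_part finX by blast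
    have Y: "?Y \<in> cyclic_flats M" "?Y \<subseteq> W"
      using flat_closure cyclic_closure CE cyc closure_subset_flat[OF flatW] X cyclic_part_subset[of X]
      by (auto simp: cyclic_flats_iff)
    have sub: "?C \<subseteq> ?Y" using subset_closure CE by blast
    \<comment> \<open>Here cyclicity of \<open>Z\<close> enters: its elements are removable in
      \<open>Z\<close> and hence in \<open>X\<close>.\<close>
    have ZC: "Z \<subseteq> ?C"
      using Z X rank_Diff_mono[of Z _ X] by (auto simp: cyclic_flats_iff cyclic_def cyclic_part_def)
    \<comment> \<open>The lower bound is the rank of \<open>X\<close>, which splits into the rank of
      \<open>?Y\<close> and the number of coloops; these coloops are exactly the elements outside
      \<open>?Y\<close>.\<close>
    have "rank M (X \<union> ?Y) = rank M ?Y + card (X \<union> ?Y - ?Y)"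
    proof -
      have d: "X \<union> ?Y - ?Y = X - ?C" using inter[OF X(2)] by auto
      have un: "?Y \<union> (X - ?C) = X \<union> ?Y" using sub by auto
      have "rank M X \<le> rank M (X \<union> ?Y)" by (rule rank_mono) auto
      moreover have "rank M (X \<union> ?Y) \<le> rank M ?Y + card (X - ?C)"
        using rank_Un_le[of "X - ?C" ?Y] finX un by simp
      ultimately show ?thesis
        using rank_cyclic_part[OF finX] rank_closure[OF CE] d by simp
    qed
    then show "(?Y, ?C, X \<union> ?Y) \<in> ?A"
      using Y sub ZC cyc rank_closure[OF CE] X
      by (auto simp: spanning_cyclic_def indep_over_def)
  qed
  show ?thesis by (rule bij_betw_byWitness[OF left right im im2])
qed

lemma sum_glue:
  fixes f :: "'a set \<Rightarrow> 'c::comm_monoid_add"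
  assumes "Z \<in> cyclic_flats M" "W \<in> cyclic_flats M"
  shows "(\<Sum>X | Z \<subseteq> X \<and> X \<subseteq> W. f X) =
    (\<Sum>Y | Y \<in> cyclic_flats M \<and> Z \<subseteq> Y \<and> Y \<subseteq> W.
      \<Sum>C\<in>spanning_cyclic M Z Y. \<Sum>J\<in>indep_over M Y W. f (C \<union> (J - Y)))"
proof -
  have "(\<Sum>X | Z \<subseteq> X \<and> X \<subseteq> W. f X) =
    (\<Sum>(Y, C, J)\<in>(SIGMA Y:{Y \<in> cyclic_flats M. Z \<subseteq> Y \<and> Y \<subseteq> W}.
      spanning_cyclic M Z Y \<times> indep_over M Y W). f (C \<union> (J - Y)))"
    using sum.reindex_bij_betw[OF bij_betw_glue[OF assms], of f] by (simp add: case_prod_unfold)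
  also have "\<dots> = (\<Sum>Y | Y \<in> cyclic_flats M \<and> Z \<subseteq> Y \<and> Y \<subseteq> W.
      \<Sum>(C, J)\<in>spanning_cyclic M Z Y \<times> indep_over M Y W. f (C \<union> (J - Y)))"
    using finite_cyclic_flats assms finite_cyclic_flat
    by (subst sum.Sigma)
       (auto intro!: finite_spanning_cyclic finite_indep_over simp: case_prod_unfold)
  finally show ?thesis by (simp add: sum.cartesian_product)
qed

end

section \<open>Generating polynomials of the two kinds of sets\<close>

lemma sum_monom_card_Pow:
  "finite S \<Longrightarrow> (\<Sum>X\<in>Pow S. monom 1 (card X)) = ([:1, 1:] :: int poly) ^ card S"
proof (induction S rule: finite_induct)
  case empty
  then show ?case by (simp add: one_pCons)
next
  case (insert a S)
  have inj: "inj_on (insert a) (Pow S)"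
    using insert.hyps by (auto simp: inj_on_def)
  have "(\<Sum>X\<in>Pow (insert a S). monom (1::int) (card X)) =
      (\<Sum>X\<in>Pow S. monom 1 (card X)) + (\<Sum>X\<in>insert a ` Pow S. monom 1 (card X))"
    unfolding Pow_insert using insert.hyps by (intro sum.union_disjoint) auto
  also have "(\<Sum>X\<in>insert a ` Pow S. monom (1::int) (card X)) = (\<Sum>X\<in>Pow S. monom 1 (card (insert a X)))"
    using sum.reindex[OF inj, of "\<lambda>X. monom (1::int) (card X)"] by (simp add: o_def)
  also have "\<dots> = (\<Sum>X\<in>Pow S. [:0, 1:] * monom 1 (card X))"
  proof (rule sum.cong)
    fix X assume "X \<in> Pow S"
    then have "card (insert a X) = Suc (card X)"
      using insert.hyps finite_subset[of X S] by (subst card_insert_disjoint) auto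
    then show "monom (1::int) (card (insert a X)) = [:0, 1:] * monom 1 (card X)"
      by (simp add: monom_Suc)
  qed simp
  also have "\<dots> = [:0, 1:] * [:1, 1:] ^ card S"
    unfolding sum_distrib_left[symmetric] insert.IH ..
  finally show ?case using insert by (simp add: algebra_simps)
qed

definition spanning_cyclic_poly :: "'a matroid \<Rightarrow> 'a set \<Rightarrow> 'a set \<Rightarrow> int poly" where
  "spanning_cyclic_poly M Z Y = (\<Sum>C\<in>spanning_cyclic M Z Y. monom 1 (card (C - Z)))"

definition indep_over_poly :: "'a matroid \<Rightarrow> 'a set \<Rightarrow> 'a set \<Rightarrow> int poly" where
  "indep_over_poly M Y W = (\<Sum>J\<in>indep_over M Y W. monom 1 (card (J - Y)))"

text \<open>The upper end is a single flat, not a block: that the sum is constant on the block of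
  \<open>Y\<close> is only a consequence of \<open>block_polys_eq\<close>.\<close>

definition block_cyclic_poly :: "'a matroid \<Rightarrow> 'a set set \<Rightarrow> 'a set \<Rightarrow> int poly" where
  "block_cyclic_poly M B Y = (\<Sum>Z | Z \<in> B \<and> Z \<subseteq> Y. spanning_cyclic_poly M Z Y)"

definition block_indep_poly :: "'a matroid \<Rightarrow> 'a set set \<Rightarrow> 'a set \<Rightarrow> int poly" where
  "block_indep_poly M B W = (\<Sum>Y | Y \<in> B \<and> Y \<subseteq> W. indep_over_poly M Y W)"

context matroid
begin

text \<open>Sizes relative to \<open>Z\<close> add up under gluing,
  \<open>card (C - Z) + card (J - Y)\<close>, so products of polynomials enumerate the sets between
  \<open>Z\<close> and \<open>W\<close> by size.\<close>

lemma sum_cyclic_indep: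
  assumes Z: "Z \<in> cyclic_flats M" and W: "W \<in> cyclic_flats M" and ZW: "Z \<subseteq> W"
  shows "(\<Sum>Y | Y \<in> cyclic_flats M \<and> Z \<subseteq> Y \<and> Y \<subseteq> W.
      spanning_cyclic_poly M Z Y * indep_over_poly M Y W) = [:1, 1:] ^ (card W - card Z)"
proof -
  note fin = finite_cyclic_flat[OF Z] finite_cyclic_flat[OF W]
  have "spanning_cyclic_poly M Z Y * indep_over_poly M Y W = (\<Sum>C\<in>spanning_cyclic M Z Y.
      \<Sum>J\<in>indep_over M Y W. monom 1 (card (C \<union> (J - Y) - Z)))" for Y
    unfolding spanning_cyclic_poly_def indep_over_poly_def sum_product mult_monom
  proof (intro sum.cong refl)
    fix C J assume CJ: "C \<in> spanning_cyclic M Z Y" "J \<in> indep_over M Y W"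
    then have sub: "Z \<subseteq> C" "C \<subseteq> W" by (auto simp: spanning_cyclic_def indep_over_def)
    then have "card Z \<le> card C" using fin finite_subset by (blast intro: card_mono)
    moreover have "card (C \<union> (J - Y) - Z) = card C + card (J - Y) - card Z"
      using card_glue[OF CJ fin(2)] sub fin by (subst card_Diff_subset) auto
    moreover have "card (C - Z) = card C - card Z"
      using sub fin by (intro card_Diff_subset) auto
    ultimately show "monom (1 * 1 :: int) (card (C - Z) + card (J - Y)) =
        monom 1 (card (C \<union> (J - Y) - Z))" by simp
  qed
  then have "(\<Sum>Y | Y \<in> cyclic_flats M \<and> Z \<subseteq> Y \<and> Y \<subseteq> W.
      spanning_cyclic_poly M Z Y * indep_over_poly M Y W) =
      (\<Sum>X | Z \<subseteq> X \<and> X \<subseteq> W. monom 1 (card (X - Z)))"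
    using sum_glue[OF Z W, of "\<lambda>X. monom (1::int) (card (X - Z))"] by simp
  also have "\<dots> = (\<Sum>S\<in>Pow (W - Z). monom 1 (card S))"
    by (rule sum.reindex_bij_witness[where i = "\<lambda>S. S \<union> Z" and j = "\<lambda>X. X - Z"])
       (use ZW in auto)
  also have "\<dots> = [:1, 1:] ^ card (W - Z)" using sum_monom_card_Pow fin by blast
  finally show ?thesis using fin ZW by (simp add: card_Diff_subset)
qed

text \<open>\<open>sum_cyclic_indep\<close> is summed over the members of \<open>B\<close> below
  \<open>W\<close>; exchanging the sums collects, for each \<open>Y\<close>, the members of
  \<open>B\<close> below \<open>Y\<close>.\<close>

lemma sum_block_cyclic:
  assumes B: "B \<subseteq> cyclic_flats M" and W: "W \<in> cyclic_flats M"
  shows "(\<Sum>Z | Z \<in> B \<and> Z \<subseteq> W. [:1, 1:] ^ (card W - card Z)) =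
    (\<Sum>Y | Y \<in> cyclic_flats M \<and> Y \<subseteq> W. block_cyclic_poly M B Y * indep_over_poly M Y W)"
proof -
  let ?g = "\<lambda>Z Y. spanning_cyclic_poly M Z Y * indep_over_poly M Y W"
  have finB: "finite B" using B finite_cyclic_flats finite_subset by blast
  have "(\<Sum>Z | Z \<in> B \<and> Z \<subseteq> W. [:1, 1:] ^ (card W - card Z)) =
      (\<Sum>Z\<in>{Z \<in> B. Z \<subseteq> W}. \<Sum>Y\<in>{Y \<in> {Y \<in> cyclic_flats M. Y \<subseteq> W}. Z \<subseteq> Y}. ?g Z Y)"
  proof (rule sum.cong[OF refl])
    fix Z assume "Z \<in> {Z \<in> B. Z \<subseteq> W}"
    moreover have "{Y \<in> {Y \<in> cyclic_flats M. Y \<subseteq> W}. Z \<subseteq> Y} =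
        {Y. Y \<in> cyclic_flats M \<and> Z \<subseteq> Y \<and> Y \<subseteq> W}" by auto
    ultimately show "[:1, 1:] ^ (card W - card Z) =
        (\<Sum>Y\<in>{Y \<in> {Y \<in> cyclic_flats M. Y \<subseteq> W}. Z \<subseteq> Y}. ?g Z Y)"
      using sum_cyclic_indep[of Z W] B W by auto
  qed
  also have "\<dots> = (\<Sum>Y\<in>{Y \<in> cyclic_flats M. Y \<subseteq> W}. \<Sum>Z\<in>{Z \<in> {Z \<in> B. Z \<subseteq> W}. Z \<subseteq> Y}. ?g Z Y)"
    using finB finite_cyclic_flats by (intro sum.swap_restrict) auto
  also have "\<dots> = (\<Sum>Y\<in>{Y \<in> cyclic_flats M. Y \<subseteq> W}. block_cyclic_poly M B Y * indep_over_poly M Y W)"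
  proof (rule sum.cong[OF refl])
    fix Y assume "Y \<in> {Y \<in> cyclic_flats M. Y \<subseteq> W}"
    then have "{Z \<in> {Z \<in> B. Z \<subseteq> W}. Z \<subseteq> Y} = {Z. Z \<in> B \<and> Z \<subseteq> Y}" by auto
    then show "(\<Sum>Z\<in>{Z \<in> {Z \<in> B. Z \<subseteq> W}. Z \<subseteq> Y}. ?g Z Y) =
        block_cyclic_poly M B Y * indep_over_poly M Y W"
      by (simp add: block_cyclic_poly_def sum_distrib_right)
  qed
  finally show ?thesis .
qed

lemma spanning_cyclic_poly_self:
  assumes "Z \<in> cyclic_flats M"
  shows "spanning_cyclic_poly M Z Z = 1"
proof -
  have "spanning_cyclic M Z Z = {Z}"
    using assms by (auto simp: spanning_cyclic_def cyclic_flats_iff)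
  then show ?thesis by (simp add: spanning_cyclic_poly_def)
qed

lemma indep_over_poly_self: "indep_over_poly M Z Z = 1"
proof -
  have "indep_over M Z Z = {Z}" by (auto simp: indep_over_def)
  then show ?thesis by (simp add: indep_over_poly_def)
qed

text \<open>Since \<open>C\<close> spans more than \<open>Z\<close>, some \<open>e\<close> lies in
  \<open>C - Z\<close>. Cyclicity lets \<open>e\<close> be dropped without loss of rank, so
  \<open>C - Z\<close> has at least one element more than the rank difference.\<close>

lemma coeff_spanning_cyclic_poly_eq_0:
  assumes Z: "Z \<in> cyclic_flats M" and Y: "Y \<in> cyclic_flats M" and "Z \<subset> Y"
    and k: "k \<le> rank M Y - rank M Z"
  shows "coeff (spanning_cyclic_poly M Z Y) k = 0"
proof -
  have "card (C - Z) \<noteq> k" if C: "C \<in> spanning_cyclic M Z Y" for C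
  proof -
    have C': "Z \<subseteq> C" "C \<subseteq> Y" "cyclic M C" "rank M C = rank M Y"
      using C by (auto simp: spanning_cyclic_def)
    have less: "rank M Z < rank M Y" using cyclic_flat_rank_less assms by blast
    then obtain e where e: "e \<in> C - Z" using C'
      by (metis Diff_eq_empty_iff equals0I less_irrefl subset_antisym)
    have fin: "finite (C - Z)" using C' Y finite_cyclic_flat finite_subset by blast
    have "Z \<union> (C - Z - {e}) = C - {e}" using e C' by auto
    then have "rank M (C - {e}) \<le> rank M Z + card (C - Z - {e})"
      using rank_Un_le[of "C - Z - {e}" Z] fin by simp
    moreover have "rank M (C - {e}) = rank M Y" using C' e by (auto simp: cyclic_def)
    moreover have "card (C - Z - {e}) < card (C - Z)" by (rule card_Diff1_less[OF fin e])
    ultimately show ?thesis using k by simp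
  qed
  then show ?thesis by (auto simp: spanning_cyclic_poly_def coeff_sum)
qed

lemma coeff_indep_over_poly_eq_0:
  assumes "rank M W - rank M Y < k"
  shows "coeff (indep_over_poly M Y W) k = 0"
proof -
  have "card (J - Y) \<noteq> k" if "J \<in> indep_over M Y W" for J
    using that assms rank_mono[of J W] by (auto simp: indep_over_def)
  then show ?thesis by (auto simp: indep_over_poly_def coeff_sum)
qed

text \<open>For a set glued from \<open>C\<close> and \<open>J\<close>, the exponent of x depends
  only on \<open>J\<close> and that of y only on \<open>C\<close>, so the sum over each
  \<open>Y\<close> factors. The condition on \<open>i\<close> matters: truncated subtraction would
  otherwise read off the constant coefficient.\<close>

lemma coeff_rank_gen_poly:
  assumes "{} \<in> cyclic_flats M" "ground M \<in> cyclic_flats M"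
  shows "coeff (coeff (rank_gen_poly M) i) j =
    (\<Sum>Y\<in>cyclic_flats M. coeff (spanning_cyclic_poly M {} Y) (j + rank M Y) *
      (if i \<le> rank M (ground M) - rank M Y
       then coeff (indep_over_poly M Y (ground M)) (rank M (ground M) - rank M Y - i) else 0))"
proof -
  let ?E = "ground M"
  \<comment> \<open>The indicator of the subsets that contribute to the monomial with exponents
    \<open>i\<close> and \<open>j\<close>.\<close>
  define f :: "'a set \<Rightarrow> int" where
    "f X = (if rank M ?E - rank M X = i \<and> card X - rank M X = j then 1 else 0)" for X
  have "coeff (coeff (rank_gen_poly M) i) j = (\<Sum>X | {} \<subseteq> X \<and> X \<subseteq> ?E. f X)"
    by (auto simp: rank_gen_poly_def coeff_sum f_def Pow_def intro!: sum.cong)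
  also have "\<dots> = (\<Sum>Y | Y \<in> cyclic_flats M \<and> {} \<subseteq> Y \<and> Y \<subseteq> ?E.
      \<Sum>C\<in>spanning_cyclic M {} Y. \<Sum>J\<in>indep_over M Y ?E. f (C \<union> (J - Y)))"
    by (rule sum_glue[OF assms])
  also have "{Y. Y \<in> cyclic_flats M \<and> {} \<subseteq> Y \<and> Y \<subseteq> ?E} = cyclic_flats M"
    using cyclic_flats_subset_ground by auto
  also have "(\<Sum>Y\<in>cyclic_flats M. \<Sum>C\<in>spanning_cyclic M {} Y. \<Sum>J\<in>indep_over M Y ?E. f (C \<union> (J - Y))) =
     (\<Sum>Y\<in>cyclic_flats M. (\<Sum>C\<in>spanning_cyclic M {} Y. if card C = j + rank M Y then 1 else 0) *
       (\<Sum>J\<in>indep_over M Y ?E. if i \<le> rank M ?E - rank M Y \<and>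
          card (J - Y) = rank M ?E - rank M Y - i then 1 else 0))"
    unfolding sum_product
  proof (intro sum.cong refl)
    fix Y C J assume Y: "Y \<in> cyclic_flats M" and CJ: "C \<in> spanning_cyclic M {} Y" "J \<in> indep_over M Y ?E"
    have finC: "finite C" and rC: "rank M C = rank M Y"
      using CJ finite_subset[of C Y] finite_cyclic_flat[OF Y]
      by (auto simp: spanning_cyclic_def)
    have "rank M C \<le> card C" using finC by (rule rank_le_card)
    moreover note rC
    moreover have "rank M J \<le> rank M ?E" "rank M J = rank M Y + card (J - Y)"
      using CJ rank_mono[of J ?E] by (auto simp: indep_over_def)
    ultimately have "rank M ?E - (rank M Y + card (J - Y)) = i \<and>
        card C + card (J - Y) - (rank M Y + card (J - Y)) = j \<longleftrightarrow>
        card C = j + rank M Y \<and> i \<le> rank M ?E - rank M Y \<and>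
        card (J - Y) = rank M ?E - rank M Y - i" by linarith
    then show "f (C \<union> (J - Y)) = (if card C = j + rank M Y then 1 else 0) *
        (if i \<le> rank M ?E - rank M Y \<and> card (J - Y) = rank M ?E - rank M Y - i then 1 else 0)"
      unfolding f_def rank_glue[OF CJ finite_ground] card_glue[OF CJ finite_ground] by simp
  qed
  also have "\<dots> = (\<Sum>Y\<in>cyclic_flats M. coeff (spanning_cyclic_poly M {} Y) (j + rank M Y) *
      (if i \<le> rank M ?E - rank M Y
       then coeff (indep_over_poly M Y ?E) (rank M ?E - rank M Y - i) else 0))"
    by (intro sum.cong refl) (simp add: spanning_cyclic_poly_def indep_over_poly_def coeff_sum)
  finally show ?thesis .
qed

end

section \<open>Condensations\<close>

lemma low_high_split_unique:
  fixes p p' q q' :: "int poly"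
  assumes "\<And>k. k \<le> n \<Longrightarrow> coeff p k = 0" "\<And>k. k \<le> n \<Longrightarrow> coeff p' k = 0"
    and "\<And>k. n < k \<Longrightarrow> coeff q k = 0" "\<And>k. n < k \<Longrightarrow> coeff q' k = 0"
    and "p + q = p' + q'"
  shows "p = p'" "q = q'"
proof -
  have sum: "coeff p k + coeff q k = coeff p' k + coeff q' k" for k
    using assms(5) by (metis coeff_add)
  have "coeff p k = coeff p' k" for k
    using sum[of k] assms(1-4)[of k] by (cases "k \<le> n") auto
  then show "p = p'" by (rule poly_eqI)
  then show "q = q'" using assms(5) by simp
qed

section \<open>Blocks of one condensation and the recursion for their polynomials\<close>

locale condensed_matroid = matroid M for M :: "'a matroid" +
  fixes P :: "'a set set set" and R :: "'a set set \<Rightarrow> 'a set"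
  assumes condensation: "condensation M P"
    and representative: "B \<in> P \<Longrightarrow> R B \<in> B"
begin

lemma partition_blocks: "partition_on (cyclic_flats M) P"
  using condensation unfolding condensation_def by (elim conjE)

lemma Union_blocks: "\<Union>P = cyclic_flats M"
  using partition_blocks by (simp add: partition_on_def)

lemma block_subset: "B \<in> P \<Longrightarrow> B \<subseteq> cyclic_flats M"
  using Union_blocks by auto

lemma finite_blocks: "finite P"
  using finite_cyclic_flats unfolding Union_blocks[symmetric] by (rule finite_UnionD)

lemma finite_block: "B \<in> P \<Longrightarrow> finite B"
  by (rule finite_subset[OF block_subset finite_cyclic_flats])

lemma block_unique:
  assumes "B \<in> P" "C \<in> P" "X \<in> B" "X \<in> C"
  shows "B = C"
proof -
  have "disjoint P" using partition_blocks by (simp add: partition_on_def)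
  then show ?thesis using disjointD[of P B C] assms by blast
qed

lemma card_block: "B \<in> P \<Longrightarrow> X \<in> B \<Longrightarrow> card X = card (R B)"
  and rank_block: "B \<in> P \<Longrightarrow> X \<in> B \<Longrightarrow> rank M X = rank M (R B)"
proof -
  have *: "\<forall>B\<in>P. \<forall>X\<in>B. \<forall>Y\<in>B. card X = card Y \<and> rank M X = rank M Y"
    using condensation unfolding condensation_def by (elim conjE)
  show "card X = card (R B)" "rank M X = rank M (R B)" if "B \<in> P" "X \<in> B"
    using bspec[OF bspec[OF bspec[OF *]], OF that representative[OF that(1)]] by auto
qed

lemma sum_cyclic_flats_blocks:
  "(\<Sum>Y\<in>cyclic_flats M. f Y) = (\<Sum>D\<in>P. \<Sum>Y\<in>D. f Y)"
proof -
  have "\<forall>D\<in>P. \<forall>D'\<in>P. D \<noteq> D' \<longrightarrow> D \<inter> D' = {}"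
    using block_unique by blast
  then show ?thesis
    unfolding Union_blocks[symmetric] using finite_block by (subst sum.Union_disjoint) auto
qed

lemma sum_cyclic_flats_below_blocks:
  "(\<Sum>Y | Y \<in> cyclic_flats M \<and> Y \<subseteq> W. f Y) = (\<Sum>D\<in>P. \<Sum>Y | Y \<in> D \<and> Y \<subseteq> W. f Y)"
  using sum_cyclic_flats_blocks[of "\<lambda>Y. if Y \<subseteq> W then f Y else 0"]
  by (simp add: sum.inter_filter finite_cyclic_flats finite_block)

lemma block_antichain:
  assumes "B \<in> P" "Z \<in> B" "Y \<in> B" "Z \<subseteq> Y"
  shows "Z = Y"
proof (rule card_subset_eq)
  show "finite Y" using block_subset[OF assms(1)] assms(3) finite_cyclic_flat by auto
  show "card Z = card Y"
    using card_block[OF assms(1,2)] card_block[OF assms(1,3)] by simp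
qed (rule assms(4))

text \<open>Nested cyclic flats from different blocks are distinct, so their ranks differ. This is
  what makes an induction on rank differences possible.\<close>

lemma block_less:
  assumes "B \<in> P" "C \<in> P" "B \<noteq> C" "Z \<in> B" "Y \<in> C" "Z \<subseteq> Y"
  shows "Z \<subset> Y" "rank M (R B) < rank M (R C)"
proof -
  show less: "Z \<subset> Y" using block_unique[of B C Z] assms by auto
  have "Z \<in> cyclic_flats M" "Y \<in> cyclic_flats M"
    using block_subset[of B] block_subset[of C] assms by auto
  then have "rank M Z < rank M Y" using less by (rule cyclic_flat_rank_less)
  then show "rank M (R B) < rank M (R C)"
    using rank_block[of B Z] rank_block[of C Y] assms by simp
qed

lemma block_below_self: "B \<in> P \<Longrightarrow> Y \<in> B \<Longrightarrow> {Z. Z \<in> B \<and> Z \<subseteq> Y} = {Y}"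
  using block_antichain by blast

lemma block_cyclic_poly_self: "B \<in> P \<Longrightarrow> Y \<in> B \<Longrightarrow> block_cyclic_poly M B Y = 1"
  using block_subset[of B] spanning_cyclic_poly_self[of Y]
  by (auto simp: block_cyclic_poly_def block_below_self)

lemma block_indep_poly_self: "B \<in> P \<Longrightarrow> Y \<in> B \<Longrightarrow> block_indep_poly M B Y = 1"
  by (simp add: block_indep_poly_def block_below_self indep_over_poly_self)

lemma block_below_empty:
  assumes "B \<in> P" "C \<in> P" "B \<noteq> C" "Y \<in> C" "\<not> rank M (R B) < rank M (R C)"
  shows "{Z. Z \<in> B \<and> Z \<subseteq> Y} = {}"
  using assms block_less(2)[of B C _ Y] by auto

lemma coeff_block_cyclic_poly_eq_0:
  assumes "B \<in> P" "C \<in> P" "B \<noteq> C" "Y \<in> C" "k \<le> rank M (R C) - rank M (R B)"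
  shows "coeff (block_cyclic_poly M B Y) k = 0"
proof -
  have "coeff (spanning_cyclic_poly M Z Y) k = 0" if "Z \<in> B" "Z \<subseteq> Y" for Z
  proof (rule coeff_spanning_cyclic_poly_eq_0)
    show "Z \<in> cyclic_flats M" "Y \<in> cyclic_flats M"
      using block_subset[OF assms(1)] block_subset[OF assms(2)] assms(4) that by auto
    show "Z \<subset> Y" using block_less(1)[OF assms(1-3) that(1) assms(4) that(2)] .
    show "k \<le> rank M Y - rank M Z"
      using rank_block[OF assms(1) that(1)] rank_block[OF assms(2,4)] assms(5) by simp
  qed
  then show ?thesis by (simp add: block_cyclic_poly_def coeff_sum)
qed

lemma coeff_block_indep_poly_eq_0:
  assumes "B \<in> P" "C \<in> P" "Y \<in> C" "rank M (R C) - rank M (R B) < k"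
  shows "coeff (block_indep_poly M B Y) k = 0"
proof -
  have "coeff (indep_over_poly M Z Y) k = 0" if "Z \<in> B" for Z
    using rank_block[OF assms(1) that] rank_block[OF assms(2,3)] assms(4)
    by (intro coeff_indep_over_poly_eq_0) simp
  then show ?thesis by (simp add: block_indep_poly_def coeff_sum)
qed

text \<open>The sum over all \<open>Y\<close> below \<open>W\<close> is sorted by blocks. The block
  \<open>B\<close> contributes \<open>block_indep_poly M B W\<close>, the block \<open>C\<close>
  contributes \<open>block_cyclic_poly M B W\<close> through \<open>Y = W\<close> alone. On blocks
  between them the assumed constant value \<open>g D\<close> factors out; the induction hypothesis
  will supply it.\<close>

lemma block_recursion:
  assumes B: "B \<in> P" and C: "C \<in> P" and BC: "B \<noteq> C" and W: "W \<in> C"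
    and g: "\<And>D Y. D \<in> P \<Longrightarrow> D \<noteq> B \<Longrightarrow> D \<noteq> C \<Longrightarrow> rank M (R B) < rank M (R D) \<Longrightarrow>
      rank M (R D) < rank M (R C) \<Longrightarrow> Y \<in> D \<Longrightarrow> block_cyclic_poly M B Y = g D"
  shows "block_cyclic_poly M B W + block_indep_poly M B W =
    of_nat (incidence B C) * [:1, 1:] ^ (card (R C) - card (R B)) -
    (\<Sum>D\<in>{D \<in> P - {B, C}. rank M (R B) < rank M (R D) \<and> rank M (R D) < rank M (R C)}.
      g D * block_indep_poly M D W)"
proof -
  let ?t = "\<lambda>D. \<Sum>Y | Y \<in> D \<and> Y \<subseteq> W. block_cyclic_poly M B Y * indep_over_poly M Y W"
  let ?I = "{D \<in> P - {B, C}. rank M (R B) < rank M (R D) \<and> rank M (R D) < rank M (R C)}"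
  have "of_nat (incidence B C) * [:1, 1:] ^ (card (R C) - card (R B)) =
      (\<Sum>Z | Z \<in> B \<and> Z \<subseteq> W. ([:1, 1:] :: int poly) ^ (card W - card Z))"
    using incidence_eq[OF condensation B C W] card_block[OF B] card_block[OF C W] by simp
  also have "\<dots> = (\<Sum>D\<in>P. ?t D)"
    unfolding sum_cyclic_flats_below_blocks[symmetric]
    using block_subset[OF B] block_subset[OF C] W by (intro sum_block_cyclic) auto
  also have "\<dots> = ?t B + ?t C + (\<Sum>D\<in>P - {B, C}. ?t D)"
  proof -
    have "P - {B} - {C} = P - {B, C}" by auto
    then show ?thesis
      using sum.remove[of P B ?t] sum.remove[of "P - {B}" C ?t] finite_blocks B C BC by simp
  qed
  also have "?t B = block_indep_poly M B W"
    using block_cyclic_poly_self[OF B] by (simp add: block_indep_poly_def)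
  also have "?t C = block_cyclic_poly M B W"
    by (simp add: block_below_self[OF C W] indep_over_poly_self)
  also have "(\<Sum>D\<in>P - {B, C}. ?t D) = (\<Sum>D\<in>?I. ?t D)"
  proof (rule sum.mono_neutral_right)
    \<comment> \<open>Outside the intermediate ranks either no member of \<open>D\<close> lies below
      \<open>W\<close>, or no member of \<open>B\<close> lies below a member of
      \<open>D\<close>.\<close>
    show "\<forall>D\<in>P - {B, C} - ?I. ?t D = 0"
    proof
      fix D assume D: "D \<in> P - {B, C} - ?I"
      show "?t D = 0"
      proof (cases "rank M (R B) < rank M (R D)")
        case True
        then have "{Y. Y \<in> D \<and> Y \<subseteq> W} = {}" using D C W by (intro block_below_empty[of D C]) auto
        then show ?thesis by (simp only: sum.empty)
      next
        case False
        have "block_cyclic_poly M B Y = 0" if "Y \<in> D" for Y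
        proof -
          have "{Z. Z \<in> B \<and> Z \<subseteq> Y} = {}"
            using D B False that by (intro block_below_empty[of B D]) auto
          then show ?thesis by (simp only: block_cyclic_poly_def sum.empty)
        qed
        then show ?thesis by simp
      qed
    qed
  qed (use finite_blocks in auto)
  also have "\<dots> = (\<Sum>D\<in>?I. g D * block_indep_poly M D W)"
    unfolding block_indep_poly_def sum_distrib_left
    by (intro sum.cong refl arg_cong2[where f = "(*)"] g) auto
  finally show ?thesis by (simp add: algebra_simps)
qed

text \<open>The block \<open>L\<close> of the empty set has no other member, so its block
  polynomials are those with lower end \<open>{}\<close>. Every member of \<open>D\<close> lies
  below the ground set, so summing over \<open>D\<close> yields
  \<open>block_indep_poly M D (ground M)\<close>.\<close>

lemma coeff_rank_gen_poly_blocks: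
  assumes "L \<in> P" "{} \<in> L" "T \<in> P" "ground M \<in> T"
    and g: "\<And>D Y. D \<in> P \<Longrightarrow> Y \<in> D \<Longrightarrow> block_cyclic_poly M L Y = g D"
  shows "coeff (coeff (rank_gen_poly M) i) j =
    (\<Sum>D\<in>P. coeff (g D) (j + rank M (R D)) *
      (if i \<le> rank M (R T) - rank M (R D)
       then coeff (block_indep_poly M D (ground M)) (rank M (R T) - rank M (R D) - i) else 0))"
proof -
  let ?E = "ground M"
  have cf: "{} \<in> cyclic_flats M" "?E \<in> cyclic_flats M"
    using assms(2,4) block_subset[OF assms(1)] block_subset[OF assms(3)] by auto
  have g': "spanning_cyclic_poly M {} Y = g D" if D: "D \<in> P" "Y \<in> D" for D Y
  proof -
    have "Z = {}" if "Z \<in> L" for Z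
      using block_antichain[OF assms(1,2) that] by simp
    then have "{Z. Z \<in> L \<and> Z \<subseteq> Y} = {{}}" using assms(2) by auto
    then show ?thesis using g[OF D] by (simp add: block_cyclic_poly_def)
  qed
  have top: "rank M ?E = rank M (R T)" using rank_block[OF assms(3,4)] .
  have "coeff (coeff (rank_gen_poly M) i) j =
     (\<Sum>D\<in>P. \<Sum>Y\<in>D. coeff (g D) (j + rank M (R D)) *
      (if i \<le> rank M (R T) - rank M (R D)
       then coeff (indep_over_poly M Y ?E) (rank M (R T) - rank M (R D) - i) else 0))"
    unfolding coeff_rank_gen_poly[OF cf] sum_cyclic_flats_blocks
  proof (intro sum.cong refl)
    fix D Y assume "D \<in> P" "Y \<in> D"
    then show "coeff (spanning_cyclic_poly M {} Y) (j + rank M Y) *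
        (if i \<le> rank M ?E - rank M Y
         then coeff (indep_over_poly M Y ?E) (rank M ?E - rank M Y - i) else 0) =
      coeff (g D) (j + rank M (R D)) * (if i \<le> rank M (R T) - rank M (R D)
         then coeff (indep_over_poly M Y ?E) (rank M (R T) - rank M (R D) - i) else 0)"
      using rank_block[of D Y] top by (simp add: g')
  qed
  also have "\<dots> = (\<Sum>D\<in>P. coeff (g D) (j + rank M (R D)) *
      (if i \<le> rank M (R T) - rank M (R D)
       then coeff (block_indep_poly M D ?E) (rank M (R T) - rank M (R D) - i) else 0))"
  proof (rule sum.cong[OF refl])
    fix D assume "D \<in> P"
    then have "{Y. Y \<in> D \<and> Y \<subseteq> ?E} = D"
      using block_subset[of D] cyclic_flats_subset_ground by blast
    then show "(\<Sum>Y\<in>D. coeff (g D) (j + rank M (R D)) *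
      (if i \<le> rank M (R T) - rank M (R D)
       then coeff (indep_over_poly M Y ?E) (rank M (R T) - rank M (R D) - i) else 0)) =
      coeff (g D) (j + rank M (R D)) * (if i \<le> rank M (R T) - rank M (R D)
       then coeff (block_indep_poly M D ?E) (rank M (R T) - rank M (R D) - i) else 0)"
      by (simp add: block_indep_poly_def coeff_sum sum_distrib_left)
  qed
  finally show ?thesis .
qed

end

section \<open>Comparison of two matroids with matching condensed configurations\<close>

locale condensed_pair = M: condensed_matroid M P R + N: condensed_matroid N Q S
  for M :: "'a matroid" and P R and N :: "'b matroid" and Q S +
  fixes \<phi> :: "'a set set \<Rightarrow> 'b set set"
  assumes bij: "bij_betw \<phi> P Q"
    and incidence_map: "B \<in> P \<Longrightarrow> C \<in> P \<Longrightarrow> incidence (\<phi> B) (\<phi> C) = incidence B C"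
    and card_map: "B \<in> P \<Longrightarrow> card (S (\<phi> B)) = card (R B)"
    and rank_map: "B \<in> P \<Longrightarrow> rank N (S (\<phi> B)) = rank M (R B)"
begin

lemma map_block: "B \<in> P \<Longrightarrow> \<phi> B \<in> Q"
  using bij by (auto simp: bij_betw_def)

lemma map_block_eq_iff: "B \<in> P \<Longrightarrow> C \<in> P \<Longrightarrow> \<phi> B = \<phi> C \<longleftrightarrow> B = C"
  using bij by (auto simp: bij_betw_def inj_on_def)

lemma image_blocks: "\<phi> ` P = Q"
  using bij by (simp add: bij_betw_def)

text \<open>Induction on the rank difference with both recursions side by side. Since
  \<open>W\<close> and \<open>W'\<close> are arbitrary in their blocks, the statement also contains
  the constancy on blocks that the recursion requires.\<close>

lemma block_polys_eq:
  assumes "B \<in> P" "C \<in> P" "W \<in> C" "W' \<in> \<phi> C"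
  shows "block_cyclic_poly M B W = block_cyclic_poly N (\<phi> B) W'"
    and "block_indep_poly M B W = block_indep_poly N (\<phi> B) W'"
proof -
  have "block_cyclic_poly M B W = block_cyclic_poly N (\<phi> B) W' \<and>
      block_indep_poly M B W = block_indep_poly N (\<phi> B) W'"
    using assms
  proof (induction "rank M (R C) - rank M (R B)" arbitrary: B C W W' rule: less_induct)
    case less
    note B = \<open>B \<in> P\<close> and C = \<open>C \<in> P\<close> and W = \<open>W \<in> C\<close> and W' = \<open>W' \<in> \<phi> C\<close>
    note B' = map_block[OF B] and C' = map_block[OF C]
    \<comment> \<open>Equal blocks give the polynomial 1 and incomparable ranks give 0 on both
      sides; only the third case calls for the recursion.\<close>
    consider "B = C" | "B \<noteq> C" "\<not> rank M (R B) < rank M (R C)"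
      | "B \<noteq> C" "rank M (R B) < rank M (R C)" by blast
    then show ?case
    proof cases
      case 1
      then show ?thesis
        using M.block_cyclic_poly_self M.block_indep_poly_self N.block_cyclic_poly_self
          N.block_indep_poly_self B B' W W' by simp
    next
      case 2
      then have "{Z. Z \<in> B \<and> Z \<subseteq> W} = {}" "{Z. Z \<in> \<phi> B \<and> Z \<subseteq> W'} = {}"
        using M.block_below_empty[OF B C _ W] N.block_below_empty[OF B' C' _ W']
          map_block_eq_iff[OF B C] rank_map B C by auto
      then show ?thesis by (simp only: block_cyclic_poly_def block_indep_poly_def sum.empty)
    next
      case 3
      let ?between = "\<lambda>D. rank M (R B) < rank M (R D) \<and> rank M (R D) < rank M (R C)"
      let ?I = "{D \<in> P - {B, C}. ?between D}"
      let ?I' = "{D \<in> Q - {\<phi> B, \<phi> C}. rank N (S (\<phi> B)) < rank N (S D) \<and>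
          rank N (S D) < rank N (S (\<phi> C))}"
      define g where "g D = block_cyclic_poly M B (R D)" for D
      define g' where "g' D = block_cyclic_poly N (\<phi> B) (S D)" for D
      have gY: "block_cyclic_poly M B Y = block_cyclic_poly N (\<phi> B) Y'"
        if "D \<in> P" "?between D" "Y \<in> D" "Y' \<in> \<phi> D" for D Y Y'
        using less.hyps[of D B Y Y'] that B by auto
      \<comment> \<open>Both \<open>Y\<close> and \<open>R D\<close> are compared with the same flat
        \<open>S (\<phi> D)\<close> of the other matroid.\<close>
      have g: "block_cyclic_poly M B Y = g D" if "D \<in> P" "?between D" "Y \<in> D" for D Y
        unfolding g_def
        using gY[OF that(1,2) that(3) N.representative[OF map_block[OF that(1)]]]
          gY[OF that(1,2) M.representative[OF that(1)] N.representative[OF map_block[OF that(1)]]]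
        by simp
      have gg': "g' (\<phi> D) = g D" if "D \<in> P" "?between D" for D
        unfolding g_def g'_def
        using gY[OF that M.representative[OF that(1)] N.representative[OF map_block[OF that(1)]]]
        by simp
      have g': "block_cyclic_poly N (\<phi> B) Y = g' D"
        if D: "D \<in> Q" "rank N (S (\<phi> B)) < rank N (S D)" "rank N (S D) < rank N (S (\<phi> C))" "Y \<in> D"
        for D Y
      proof -
        obtain D0 where D0: "D0 \<in> P" "D = \<phi> D0" using D image_blocks by auto
        then have "?between D0" using D rank_map B C by simp
        then show ?thesis
          using gY[of D0 "R D0" Y] gg'[of D0] M.representative D0 D by (simp add: g_def)
      qed
      have I': "bij_betw \<phi> ?I ?I'"
        using bij map_block_eq_iff B C rank_map by (auto simp: bij_betw_def inj_on_def)
      have "(\<Sum>D\<in>?I'. g' D * block_indep_poly N D W') =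
          (\<Sum>D\<in>?I. g' (\<phi> D) * block_indep_poly N (\<phi> D) W')"
        by (rule sum.reindex_bij_betw[OF I', symmetric])
      also have "\<dots> = (\<Sum>D\<in>?I. g D * block_indep_poly M D W)"
      proof (rule sum.cong[OF refl])
        fix D assume D: "D \<in> ?I"
        \<comment> \<open>The induction hypothesis now serves the pair \<open>D\<close>,
          \<open>C\<close>, while the cyclic factor used the pair \<open>B\<close>,
          \<open>D\<close>. Both rank differences are smaller because \<open>D\<close> lies strictly
          between.\<close>
        then have "block_indep_poly M D W = block_indep_poly N (\<phi> D) W'"
          using less.hyps[of C D W W'] diff_less_mono2[of "rank M (R B)" "rank M (R D)" "rank M (R C)"]
            C W W' by simp
        then show "g' (\<phi> D) * block_indep_poly N (\<phi> D) W' = g D * block_indep_poly M D W"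
          using gg' D by simp
      qed
      finally have sums: "(\<Sum>D\<in>?I'. g' D * block_indep_poly N D W') =
          (\<Sum>D\<in>?I. g D * block_indep_poly M D W)" .
      have ne: "\<phi> B \<noteq> \<phi> C" using 3 map_block_eq_iff B C by simp
      have eq: "block_cyclic_poly M B W + block_indep_poly M B W =
          block_cyclic_poly N (\<phi> B) W' + block_indep_poly N (\<phi> B) W'"
        using M.block_recursion[OF B C 3(1) W, of g] N.block_recursion[OF B' C' ne W', of g']
          g g' sums incidence_map card_map B C by simp
      \<comment> \<open>The equal sums are split at the rank difference of the blocks, which is the
        same in both matroids.\<close>
      show ?thesis
        using low_high_split_unique[OF _ _ _ _ eq, of "rank M (R C) - rank M (R B)"]
          M.coeff_block_cyclic_poly_eq_0[OF B C 3(1) W] M.coeff_block_indep_poly_eq_0[OF B C W]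
          N.coeff_block_cyclic_poly_eq_0[OF B' C' ne W'] N.coeff_block_indep_poly_eq_0[OF B' C' W']
          rank_map[OF B] rank_map[OF C] by simp
    qed
  qed
  then show "block_cyclic_poly M B W = block_cyclic_poly N (\<phi> B) W'"
    and "block_indep_poly M B W = block_indep_poly N (\<phi> B) W'" by auto
qed

text \<open>The map takes the blocks of the empty set and of the ground set to their counterparts;
  then the block formulas for the coefficients agree term by term.\<close>

lemma rank_gen_poly_eq:
  assumes "{} \<in> cyclic_flats M" "ground M \<in> cyclic_flats M"
    and "{} \<in> cyclic_flats N" "ground N \<in> cyclic_flats N"
  shows "rank_gen_poly M = rank_gen_poly N"
proof -
  obtain L where L: "L \<in> P" "{} \<in> L" using assms M.Union_blocks by auto
  obtain T where T: "T \<in> P" "ground M \<in> T" using assms M.Union_blocks by auto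
  \<comment> \<open>The block matched with that of \<open>ground N\<close> is not yet known to be
    \<open>T\<close>. It yields \<open>card (ground N) \<le> card (ground M)\<close>, and the latter
    is the size of \<open>S (\<phi> T)\<close>, a subset of \<open>ground N\<close>; hence the two
    coincide.\<close>
  obtain T1 where T1: "T1 \<in> P" "ground N \<in> \<phi> T1"
    using assms N.Union_blocks image_blocks by (metis UnionE imageE)
  note rep = N.representative[OF map_block]
  have cf: "S (\<phi> D) \<in> cyclic_flats N" if "D \<in> P" for D
    using rep[OF that] N.block_subset[OF map_block[OF that]] by auto
  have "card (S (\<phi> L)) = 0" using card_map[OF L(1)] M.card_block[OF L] by simp
  then have L': "{} \<in> \<phi> L"
    using N.finite_cyclic_flat[OF cf[OF L(1)]] rep[OF L(1)] by simp
  have "card (ground N) = card (R T1)"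
    using card_map[OF T1(1)] N.card_block[OF map_block[OF T1(1)] T1(2)] by simp
  also have "\<dots> \<le> card (ground M)"
    using M.representative[OF T1(1)] M.block_subset[OF T1(1)] M.cyclic_flats_subset_ground
      M.finite_ground by (intro card_mono) auto
  also have "\<dots> = card (S (\<phi> T))" using card_map[OF T(1)] M.card_block[OF T] by simp
  finally have "S (\<phi> T) = ground N"
    using N.cyclic_flats_subset_ground[OF cf[OF T(1)]] N.finite_ground by (intro card_seteq) auto
  then have T': "ground N \<in> \<phi> T" using rep[OF T(1)] by simp
  define g where "g D = block_cyclic_poly M L (R D)" for D
  define g' where "g' D = block_cyclic_poly N (\<phi> L) (S D)" for D
  have gg': "g' (\<phi> D) = g D" if "D \<in> P" for D
    unfolding g_def g'_def
    using block_polys_eq(1)[OF L(1) that M.representative[OF that] rep[OF that]] by simp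
  have g: "block_cyclic_poly M L Y = g D" if "D \<in> P" "Y \<in> D" for D Y
    using block_polys_eq(1)[OF L(1) that rep[OF that(1)]] gg'[OF that(1)] by (simp add: g'_def)
  have g': "block_cyclic_poly N (\<phi> L) Y = g' D" if D: "D \<in> Q" "Y \<in> D" for D Y
  proof -
    obtain D0 where D0: "D0 \<in> P" "D = \<phi> D0" using D image_blocks by auto
    then show ?thesis
      using block_polys_eq(1)[OF L(1) D0(1) M.representative[OF D0(1)], of Y] gg'[OF D0(1)] D
      by (simp add: g_def)
  qed
  have "coeff (coeff (rank_gen_poly M) i) j = coeff (coeff (rank_gen_poly N) i) j" for i j
  proof -
    have "coeff (coeff (rank_gen_poly N) i) j =
      (\<Sum>D\<in>Q. coeff (g' D) (j + rank N (S D)) *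
      (if i \<le> rank N (S (\<phi> T)) - rank N (S D)
       then coeff (block_indep_poly N D (ground N)) (rank N (S (\<phi> T)) - rank N (S D) - i) else 0))"
      using N.coeff_rank_gen_poly_blocks[OF map_block[OF L(1)] L' map_block[OF T(1)] T' g'] .
    also have "\<dots> = (\<Sum>D\<in>P. coeff (g' (\<phi> D)) (j + rank N (S (\<phi> D))) *
      (if i \<le> rank N (S (\<phi> T)) - rank N (S (\<phi> D))
       then coeff (block_indep_poly N (\<phi> D) (ground N)) (rank N (S (\<phi> T)) - rank N (S (\<phi> D)) - i)
       else 0))"
      by (rule sum.reindex_bij_betw[OF bij, symmetric])
    also have "\<dots> = (\<Sum>D\<in>P. coeff (g D) (j + rank M (R D)) *
      (if i \<le> rank M (R T) - rank M (R D)
       then coeff (block_indep_poly M D (ground M)) (rank M (R T) - rank M (R D) - i) else 0))"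
      using block_polys_eq(2)[OF _ T T'] gg' rank_map T by (intro sum.cong refl) simp
    also have "\<dots> = coeff (coeff (rank_gen_poly M) i) j"
      using M.coeff_rank_gen_poly_blocks[OF L T g] by simp
    finally show ?thesis by simp
  qed
  then show ?thesis by (intro poly_eqI)
qed

end

text \<open>Without loops the empty set is a cyclic flat, and without coloops the ground set is one,
  so the comparison of block polynomials reaches both ends. The Tutte polynomial follows as a
  substitution instance.\<close>

theorem theorem5p4:
  fixes M :: "'a matroid" and M' :: "'b matroid"
    and P :: "'a set set set" and P' :: "'b set set set"
    and R :: "'a set set \<Rightarrow> 'a set" and R' :: "'b set set \<Rightarrow> 'b set"
    and \<phi> :: "'a set set \<Rightarrow> 'b set set"
  assumes "matroid M" and "matroid M'"
    and "\<not> (\<exists>e. loop M e)" and "\<not> (\<exists>e. coloop M e)"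
    and "\<not> (\<exists>e. loop M' e)" and "\<not> (\<exists>e. coloop M' e)"
    and "condensation M P" and "\<And>B. B \<in> P \<Longrightarrow> R B \<in> B"
    and "condensation M' P'" and "\<And>B. B \<in> P' \<Longrightarrow> R' B \<in> B"
    and "bij_betw \<phi> P P'"
    and "\<And>B C. B \<in> P \<Longrightarrow> C \<in> P \<Longrightarrow> incidence (\<phi> B) (\<phi> C) = incidence B C"
    and "\<And>B. B \<in> P \<Longrightarrow> card (R' (\<phi> B)) = card (R B)"
    and "\<And>B. B \<in> P \<Longrightarrow> rank M' (R' (\<phi> B)) = rank M (R B)"
  shows "rank_gen_poly M = rank_gen_poly M' \<and> tutte_poly M = tutte_poly M'"
proof -
  interpret condensed_pair M P R M' P' R' \<phi>
    using assms by (intro condensed_pair.intro condensed_matroid.intro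
        condensed_matroid_axioms.intro condensed_pair_axioms.intro)
  have "rank_gen_poly M = rank_gen_poly M'"
    using assms by (intro rank_gen_poly_eq matroid.empty_cyclic_flat matroid.ground_cyclic_flat)
  then show ?thesis by (simp add: tutte_poly_def)
qed

end
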